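(* Let $\mathbf{P}=\mathbf{G}_L$ and $\mathbf{Q}=\mathbf{H}_L$. Let $1\le k\le n\leq m_L\leq J$ and let $0\le l_0,\dots,l_{n-1}\le L-1$ be distinct integers. If $$\mathrm{rank}\Big(\sum_{i=0}^{n-1} a_i\mathbf{P}\mathbf{C}_L^{l_i}\mathbf{Q}\Big)=J\quad\text{for all } [a_0,\ldots,a_{n-1}]\in\mathbb{F}_q^n\setminus\{\mathbf{0}\},\qquad ( * )$$ then the circular-shift-based rank-metric code $\mathcal{C}=\mathcal{C}(\mathbf P,\mathbf Q;l_0,\dots,l_{n-1})\subseteq\mathbb{F}_q^{J\times n}$ is a $(J\times n,q^{Jk},d)$ MRD code, that is, it has $q^{Jk}$ elements and minimum rank distance $d=n-k+1$. In particular, for every constant $0\le c\le L-1$, the choice $l_j=j+c \bmod L$, $0\le j\le n-1$, satisfies $( * )$.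
   Context: Setting. $q$ is a prime, $L$ is a positive integer with $\gcd(q,L)=1$, $m_L$ is the multiplicative order of $q$ modulo $L$, $\mathcal{J}=\{j:1\le j\le L-1,\ \gcd(j,L)=1\}$, $J=|\mathcal{J}|$, and $m_L\le J$ (automatic for $L\ge 2$). $L_{\mathbb{F}_q}=L \bmod q$ is regarded as a nonzero element of $\mathbb{F}_q$. $\beta\in\mathbb{F}_{q^{m_L}}$ is a primitive $L$-th root of unity. $\mathbf{C}_L=\begin{bmatrix}\mathbf{0}&\mathbf{I}_{L-1}\\1&\mathbf{0}\end{bmatrix}$ is the $L\times L$ cyclic permutation matrix over $\mathbb{F}_q$. $\mathbf{V}_L=[\beta^{ij}]_{0\le i,j\le L-1}$ and $\widetilde{\mathbf{V}}_L=[\beta^{-ij}]_{0\le i,j\le L-1}$. For column vectors $\mathbf{x}_j$, $[\mathbf{x}_j]_{j\in\mathcal{J}}$ denotes their juxtaposition in increasing order of $j$ (similarly for $j\notin\mathcal J$, meaning $0\le j\le L-1$, $j\notin\mathcal{J}$). $\mathbf{U}=[\mathbf{u}_j]_{0\le j\le L-1}$ and $\mathbf{U}'=[\mathbf{u}'_j]_{0\le j\le L-1}$ are matrices in $\mathbb{F}_{q^{m_L}}^{J\times L}$ (columns indexed from $0$) satisfying: $\mathrm{rank}([\mathbf{u}_j]_{j\in\mathcal{J}})=J$; $[\mathbf{u}'_j]_{j\in\mathcal{J}}^{\mathrm T}=L_{\mathbb{F}_q}^{-1}[\mathbf{u}_j]_{j\in\mathcal{J}}^{-1}$; and $[\mathbf{u}_j]_{j\notin\mathcal{J}}=\mathbf{0}$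 or $[\mathbf{u}'_j]_{j\notin\mathcal{J}}=\mathbf{0}$. Put $\mathbf{G}_L=\mathbf{U}\widetilde{\mathbf{V}}_L$ ($J\times L$) and $\mathbf{H}_L=\mathbf{V}_L\mathbf{U}'^{\mathrm T}$ ($L\times J$). It is assumed that $\mathbf{U},\mathbf{U}'$ are such that $\mathbf{G}_L$ and $\mathbf{H}_L$ have all entries in $\mathbb{F}_q$. Circular-shift-based rank-metric code. For $\mathbf{P}\in\mathbb{F}_q^{J\times L}$, $\mathbf{Q}\in\mathbb{F}_q^{L\times J}$ and distinct $0\le l_0,\dots,l_{n-1}\le L-1$, $\mathcal{C}(\mathbf P,\mathbf Q;l_0,\dots,l_{n-1})$ is the set of all matrices $[\mathbf{c}_0^{\mathrm T}\ \mathbf{c}_1^{\mathrm T}\ \cdots\ \mathbf{c}_{n-1}^{\mathrm T}]\in\mathbb{F}_q^{J\times n}$ with $\mathbf{c}_i=\sum_{s=0}^{k-1}\mathbf{m}_s\mathbf{P}\mathbf{C}_L^{q^sl_i}\mathbf{Q}$, as $(\mathbf{m}_0,\dots,\mathbf{m}_{k-1})$ ranges over $k$-tuples of row vectors in $\mathbb{F}_q^J$. The rank distance of two matrices is the rank of their difference; the minimum rank distance of a code is the minimum over pairs of distinct codewords. A code $\mathcal{M}\subseteq\mathbb{F}_q^{N\times n}$ ($n\le N$) with minimum rank distance $d$ is MRD if $|\mathcal{M}|=q^{N(n-d+1)}$. *)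

theory Defs
  imports
    "HOL-Number_Theory.Number_Theory"
    "HOL-Library.Cardinality"
    "Jordan_Normal_Form.DL_Rank"
    "Jordan_Normal_Form.DL_Submatrix"
    "Jordan_Normal_Form.Gauss_Jordan_Elimination"
    "Jordan_Normal_Form.Ring_Hom_Matrix"
begin

definition primitive_root_of_unity :: "nat \<Rightarrow> 'a::field \<Rightarrow> bool" where
  "primitive_root_of_unity L \<beta> \<longleftrightarrow> 0 < L \<and> \<beta> ^ L = 1 \<and> (\<forall>i. 0 < i \<and> i < L \<longrightarrow> \<beta> ^ i \<noteq> 1)"

definition coprime_indices :: "nat \<Rightarrow> nat set" where
  "coprime_indices L = {j. 1 \<le> j \<and> j \<le> L - 1 \<and> coprime j L}"

definition cyclic_perm_mat :: "nat \<Rightarrow> 'a::{zero,one} mat" where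
  "cyclic_perm_mat L =
     four_block_mat (0\<^sub>m (L - 1) 1) (1\<^sub>m (L - 1)) (1\<^sub>m 1) (0\<^sub>m 1 (L - 1))"

definition vandermonde_mat :: "nat \<Rightarrow> 'a::field \<Rightarrow> 'a mat" where
  "vandermonde_mat L \<beta> = mat L L (\<lambda>(i, j). \<beta> ^ (i * j))"

text \<open>
  \<open>submatrix\<close> keeps the selected columns in
  increasing order of their index.
\<close>

definition select_cols :: "'a mat \<Rightarrow> nat set \<Rightarrow> 'a mat" where
  "select_cols A S = submatrix A UNIV S"

definition mat_rank :: "'a::field mat \<Rightarrow> nat" where
  "mat_rank A = vec_space.rank (dim_row A) A"

text \<open>
  Meaningful for codes with at least two codewords; otherwise the minimum is over the empty set.
\<close>

definition min_rank_dist :: "'a::field mat set \<Rightarrow> nat" where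
  "min_rank_dist \<C> = Min {mat_rank (A - B) |A B. A \<in> \<C> \<and> B \<in> \<C> \<and> A \<noteq> B}"

definition is_MRD_code :: "nat \<Rightarrow> nat \<Rightarrow> nat \<Rightarrow> nat \<Rightarrow> 'a::{field,finite} mat set \<Rightarrow> bool" where
  "is_MRD_code N n M d \<C> \<longleftrightarrow>
     n \<le> N \<and> \<C> \<subseteq> carrier_mat N n \<and> card \<C> = M \<and> min_rank_dist \<C> = d \<and>
     card \<C> = CARD('a) ^ (N * (n - d + 1))"

text \<open>
  Vectors carry no orientation here: the row vector \<open>v M\<close> is
  \<open>transpose_mat M *\<^sub>v v\<close>, which is then used as a column of the codeword.
\<close>

definition circ_shift_codeword ::
  "nat \<Rightarrow> nat \<Rightarrow> nat \<Rightarrow> nat \<Rightarrow> 'a::{field,finite} mat \<Rightarrow> 'a mat \<Rightarrow> (nat \<Rightarrow> nat) \<Rightarrow> (nat \<Rightarrow> 'a vec) \<Rightarrow> 'a mat" where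
  "circ_shift_codeword L J n k P Q l msg =
     mat_of_cols J (map (\<lambda>i.
       finsum_vec TYPE('a) J
         (\<lambda>s. transpose_mat (P * cyclic_perm_mat L ^\<^sub>m (CARD('a) ^ s * l i) * Q) *\<^sub>v msg s)
         {..<k}) [0..<n])"

definition circ_shift_code ::
  "nat \<Rightarrow> nat \<Rightarrow> nat \<Rightarrow> nat \<Rightarrow> 'a::{field,finite} mat \<Rightarrow> 'a mat \<Rightarrow> (nat \<Rightarrow> nat) \<Rightarrow> 'a mat set" where
  "circ_shift_code L J n k P Q l =
     {circ_shift_codeword L J n k P Q l msg |msg. \<forall>s<k. msg s \<in> carrier_vec J}"

definition full_rank_combinations ::
  "nat \<Rightarrow> nat \<Rightarrow> nat \<Rightarrow> 'a::field mat \<Rightarrow> 'a mat \<Rightarrow> (nat \<Rightarrow> nat) \<Rightarrow> bool" where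
  "full_rank_combinations L J n P Q l \<longleftrightarrow>
     (\<forall>a \<in> carrier_vec n. a \<noteq> 0\<^sub>v n \<longrightarrow>
        mat_rank (finsum (module_mat TYPE('a) J J)
          (\<lambda>i. (a $ i) \<cdot>\<^sub>m (P * cyclic_perm_mat L ^\<^sub>m l i * Q)) {..<n}) = J)"

end

theory Submission
  imports Defs
begin

text \<open>
  The columns of the Vandermonde matrix are eigenvectors of the cyclic permutation matrix, so over
  the extension field the matrices \<open>P C\<^sup>e Q\<close> are simultaneously diagonal: they equal
  \<open>T diag(\<gamma>\<^sub>r\<^sup>e) T\<^sup>-\<^sup>1\<close>, where \<open>\<gamma>\<^sub>r = \<beta>\<^sup>j\<close> and \<open>j\<close> is the \<open>r\<close>-th index
  coprime to \<open>L\<close>. The full rank condition therefore says that, for every \<open>r\<close>, the elements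
  \<open>\<gamma>\<^sub>r\<^sup>l\<close> for the \<open>n\<close> shifts \<open>l\<close> are linearly independent over the base field.
  If \<open>W\<close> is a codeword, then the vectors \<open>a\<close> with \<open>W a = 0\<close> are sent injectively by
  \<open>a \<mapsto> \<Sum>a\<^sub>i \<gamma>\<^sub>r\<^bsup>l i\<^esup>\<close> to roots of a \<open>q\<close>-polynomial of degree at most
  \<open>q\<^bsup>k - 1\<^esup>\<close> (as for Gabidulin codes). For a nonzero message some \<open>r\<close> gives a nonzero
  polynomial, which bounds the kernel and hence the rank from below by \<open>n - k + 1\<close>.
  For consecutive shifts, a vanishing combination would be a polynomial of degree below \<open>m\<close>
  over the base field with the \<open>m\<close> distinct conjugates of \<open>\<gamma>\<^sub>r\<close> as roots.
\<close>

subsection \<open>Rank and kernel over a finite field\<close>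

lemma bij_betw_vec_carrier_vec: "bij_betw (vec n) ({..<n} \<rightarrow>\<^sub>E UNIV) (carrier_vec n)"
  by (rule bij_betwI[where g = "\<lambda>v. restrict (vec_index v) {..<n}"])
    (auto simp: PiE_iff extensional_def fun_eq_iff)

lemma finite_carrier_vec [simp]: "finite (carrier_vec n :: 'a::finite vec set)"
  using bij_betw_finite[OF bij_betw_vec_carrier_vec] by (metis finite finite_PiE finite_lessThan)

lemma card_carrier_vec: "card (carrier_vec n :: 'a::finite vec set) = CARD('a) ^ n"
  using bij_betw_same_card[OF bij_betw_vec_carrier_vec, symmetric] by (simp add: card_PiE)

text \<open>Independent sets of columns are bounded in size, so a maximal one exists; each such set
  has as many elements as the rank.\<close>

lemma (in vec_space) maximal_lin_indpt_cols:
  assumes A: "A \<in> carrier_mat n nc"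
  obtains S where "maximal S (\<lambda>T. T \<subseteq> set (cols A) \<and> lin_indpt T)" "rank A = card S"
proof -
  obtain S where S: "maximal S (\<lambda>T. T \<subseteq> set (cols A) \<and> lin_indpt T)"
    using maximal_exists[of "\<lambda>T. T \<subseteq> set (cols A) \<and> lin_indpt T" "card (set (cols A))" "{}"]
    by (meson List.finite_set card_mono empty_iff empty_subsetI finite_lin_indpt2 rev_finite_subset)
  show thesis
    using that[OF S rank_card_indpt[OF A S]] .
qed

text \<open>Every value \<open>A *\<^sub>v x\<close> lies in the column span, hence in the span of a
  maximal independent set of \<open>mat_rank A\<close> columns; its elements are given by at most
  \<open>CARD('a) ^ mat_rank A\<close> choices of coefficients.\<close>

lemma card_mult_mat_vec_image_le:
  fixes A :: "'a::{field,finite} mat"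
  assumes A: "A \<in> carrier_mat nr nc"
  shows "card ((*\<^sub>v) A ` carrier_vec nc) \<le> CARD('a) ^ mat_rank A"
proof -
  interpret vec_space "TYPE('a)" nr .
  have cols: "set (cols A) \<subseteq> carrier_vec nr"
    using cols_dim A by blast
  obtain S where S: "maximal S (\<lambda>T. T \<subseteq> set (cols A) \<and> lin_indpt T)" and rank: "rank A = card S"
    using maximal_lin_indpt_cols[OF A] .
  have S': "S \<subseteq> set (cols A)" "lin_indpt S" and fin: "finite S"
    using S finite_subset by (auto simp: maximal_def)
  have Sc: "S \<subseteq> carrier_vec nr" using S' cols by blast
  have rank: "mat_rank A = card S"
    using rank A by (simp add: mat_rank_def)
  \<comment> \<open>By maximality: a column outside the span could be adjoined to \<open>S\<close>
    without losing independence.\<close>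
  have cols_span: "set (cols A) \<subseteq> span S"
  proof
    fix x assume x: "x \<in> set (cols A)"
    show "x \<in> span S"
    proof (rule ccontr)
      assume nx: "x \<notin> span S"
      hence "x \<notin> S" using in_own_span[OF Sc] by blast
      with nx have "lin_indpt (S \<union> {x})"
        using lin_dep_iff_in_span[OF Sc S'(2), of x] x cols by blast
      hence "S \<union> {x} = S"
        using S x S' unfolding maximal_def by blast
      thus False using \<open>x \<notin> S\<close> by blast
    qed
  qed
  have "(*\<^sub>v) A ` carrier_vec nc \<subseteq> span S"
  proof
    fix y assume "y \<in> (*\<^sub>v) A ` carrier_vec nc"
    then obtain x where x: "x \<in> carrier_vec nc" "y = A *\<^sub>v x" by auto
    have "y \<in> span (set (cols A))"
      using x A col_space_eq[OF A] unfolding col_space_def by auto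
    thus "y \<in> span S"
      using span_subsetI[OF Sc cols_span] by blast
  qed
  also have "span S = (\<lambda>f. lincomb f S) ` (S \<rightarrow>\<^sub>E UNIV)"
  proof -
    have "span S = {lincomb a S |a. a \<in> S \<rightarrow> UNIV}"
      using finite_span[OF fin] Sc by simp
    also have "\<dots> = (\<lambda>f. lincomb f S) ` (S \<rightarrow>\<^sub>E UNIV)"
    proof -
      \<comment> \<open>Values outside \<open>S\<close> do not affect the combination, so the
        coefficient functions can be drawn from a finite set.\<close>
      have "lincomb a S = lincomb (restrict a S) S" for a
        by (rule lincomb_cong[OF refl Sc]) (auto simp: Sc)
      thus ?thesis by (auto simp: image_iff) (metis restrict_PiE_iff UNIV_I)
    qed
    finally show ?thesis .
  qed
  finally have "card ((*\<^sub>v) A ` carrier_vec nc) \<le> card ((\<lambda>f. lincomb f S) ` (S \<rightarrow>\<^sub>E (UNIV :: 'a set)))"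
    by (intro card_mono finite_imageI finite_PiE fin) auto
  also have "\<dots> \<le> card (S \<rightarrow>\<^sub>E (UNIV :: 'a set))"
    by (intro card_image_le finite_PiE fin) auto
  also have "\<dots> = CARD('a) ^ mat_rank A"
    using fin by (simp add: card_PiE rank)
  finally show ?thesis .
qed

lemma eq_vec_if_minus_eq_zero:
  fixes v w :: "'a::group_add vec"
  assumes "v \<in> carrier_vec n" "w \<in> carrier_vec n" "v - w = 0\<^sub>v n"
  shows "v = w"
proof (rule eq_vecI)
  fix i assume "i < dim_vec w"
  hence i: "i < n" using assms by simp
  have "(v - w) $ i = 0"
    unfolding assms(3) using i by simp
  thus "v $ i = w $ i" using assms(1,2) i by simp
qed (use assms in simp)

text \<open>The domain is the union of the fibers, and translation by one preimage injects each
  fiber into the kernel. Together with the bound on the image, this counting form of rank-nullity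
  turns a small kernel into a large rank.\<close>

lemma card_carrier_vec_le_kernel_image:
  fixes A :: "'a::{field,finite} mat"
  assumes A: "A \<in> carrier_mat nr nc"
  shows "card (carrier_vec nc :: 'a vec set) \<le>
    card {x \<in> carrier_vec nc. A *\<^sub>v x = 0\<^sub>v nr} * card ((*\<^sub>v) A ` carrier_vec nc)"
proof -
  let ?V = "carrier_vec nc :: 'a vec set"
  let ?K = "{x \<in> ?V. A *\<^sub>v x = 0\<^sub>v nr}"
  have fiber: "card {x \<in> ?V. A *\<^sub>v x = y} \<le> card ?K" if "y \<in> (*\<^sub>v) A ` ?V" for y
  proof -
    from that obtain z where z: "z \<in> ?V" "y = A *\<^sub>v z" by auto
    have "inj_on (\<lambda>x. x - z) {x \<in> ?V. A *\<^sub>v x = y}"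
    proof (rule inj_onI)
      fix x x' assume *: "x \<in> {x \<in> ?V. A *\<^sub>v x = y}" "x' \<in> {x \<in> ?V. A *\<^sub>v x = y}" "x - z = x' - z"
      have "x $ i = x' $ i" if "i < nc" for i
        using arg_cong[OF *(3), of "\<lambda>v. v $ i"] carrier_vecD[OF z(1)] that by simp
      thus "x = x'" using * by (intro eq_vecI) auto
    qed
    moreover have "(\<lambda>x. x - z) ` {x \<in> ?V. A *\<^sub>v x = y} \<subseteq> ?K"
      using z A by (auto simp: mult_minus_distrib_mat_vec)
    ultimately show ?thesis
      by (intro card_inj_on_le[of _ _ ?K]) auto
  qed
  have "?V = (\<Union>y \<in> (*\<^sub>v) A ` ?V. {x \<in> ?V. A *\<^sub>v x = y})" by auto
  hence "card ?V = card (\<Union>y \<in> (*\<^sub>v) A ` ?V. {x \<in> ?V. A *\<^sub>v x = y})"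
    by (rule arg_cong)
  also have "\<dots> \<le> (\<Sum>y \<in> (*\<^sub>v) A ` ?V. card {x \<in> ?V. A *\<^sub>v x = y})"
    by (rule card_UN_le) simp
  also have "\<dots> \<le> (\<Sum>y \<in> (*\<^sub>v) A ` ?V. card ?K)"
    by (intro sum_mono fiber)
  finally show ?thesis by (simp add: mult.commute)
qed

text \<open>The zero vector belongs to no independent set, so a maximal independent set consists of
  columns with index at least \<open>r\<close>.\<close>

lemma mat_rank_le_if_zero_cols:
  fixes A :: "'a::field mat"
  assumes A: "A \<in> carrier_mat nr nc"
    and zero: "\<And>i j. i < nr \<Longrightarrow> j < r \<Longrightarrow> A $$ (i, j) = 0" and r: "r \<le> nc"
  shows "mat_rank A \<le> nc - r"
proof -
  interpret vec_space "TYPE('a)" nr .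
  have cols: "set (cols A) \<subseteq> carrier_vec nr"
    using cols_dim A by blast
  obtain S where S: "maximal S (\<lambda>T. T \<subseteq> set (cols A) \<and> lin_indpt T)" and rank: "rank A = card S"
    using maximal_lin_indpt_cols[OF A] .
  have S': "S \<subseteq> set (cols A)" "lin_indpt S"
    using S by (auto simp: maximal_def)
  have nz: "0\<^sub>v nr \<notin> S"
    using vs_zero_lin_dep[of S] S' cols by auto
  have "S \<subseteq> col A ` {r..<nc}"
  proof
    fix x assume "x \<in> S"
    with S' obtain j where j: "j < nc" "x = col A j"
      using A by (auto simp: cols_def)
    have "\<not> j < r"
    proof
      assume "j < r"
      hence "x = 0\<^sub>v nr" using j A zero by (intro eq_vecI) auto
      thus False using nz \<open>x \<in> S\<close> by simp
    qed
    thus "x \<in> col A ` {r..<nc}" using j by auto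
  qed
  hence "card S \<le> card (col A ` {r..<nc})"
    by (intro card_mono) auto
  also have "\<dots> \<le> nc - r"
    using card_image_le[of "{r..<nc}" "col A"] by simp
  finally show ?thesis
    using rank A by (simp add: mat_rank_def)
qed

section \<open>Entrywise formulas and arithmetic of finite fields\<close>

lemma index_mult_mat_eq_sum:
  assumes "A \<in> carrier_mat nr n" "B \<in> carrier_mat n nc" "i < nr" "j < nc"
  shows "(A * B) $$ (i, j) = (\<Sum>k<n. A $$ (i, k) * B $$ (k, j))"
  using assms by (auto simp: scalar_prod_def atLeast0LessThan intro!: sum.cong)

lemma index_mult_mat_vec_eq_sum:
  assumes "A \<in> carrier_mat nr n" "v \<in> carrier_vec n" "i < nr"
  shows "(A *\<^sub>v v) $ i = (\<Sum>k<n. A $$ (i, k) * v $ k)"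
  using assms by (auto simp: scalar_prod_def atLeast0LessThan intro!: sum.cong)

lemma mat_rank_eq_iff_det:
  assumes "A \<in> carrier_mat n n"
  shows "mat_rank A = n \<longleftrightarrow> det A \<noteq> 0"
  using vec_space.det_rank_iff[OF assms] assms by (simp add: mat_rank_def)

lemma power_card_eq_same:
  fixes x :: "'a::{field,finite}"
  shows "x ^ CARD('a) = x"
proof (cases "x = 0")
  case False
  \<comment> \<open>Multiplication by a nonzero \<open>x\<close> permutes the nonzero elements;
    comparing their product before and after gives \<open>x ^ (CARD('a) - 1) = 1\<close>.\<close>
  have "bij_betw ((*) x) (UNIV - {0}) (UNIV - {0})"
    by (rule bij_betwI[where g = "\<lambda>y. y / x"]) (use False in auto)
  hence "(\<Prod>y\<in>UNIV - {0}. x * y) = \<Prod>(UNIV - {0})"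
    by (rule prod.reindex_bij_betw)
  hence "x ^ (CARD('a) - 1) = 1"
    by (simp add: prod.distrib)
  moreover have "CARD('a) = Suc (CARD('a) - 1)"
    by simp
  ultimately show ?thesis
    by (metis mult.right_neutral power_Suc)
qed simp

lemma CHAR_eq_prime_card:
  assumes "prime CARD('a::{field,finite})"
  shows "CHAR('a) = CARD('a)"
  using CHAR_dvd_CARD[where 'a='a] CHAR_not_1'[where 'a='a] assms
  by (auto simp: prime_nat_iff)

lemma finsum_module_mat_closed:
  assumes "f \<in> F \<rightarrow> carrier_mat nr nc"
  shows "finsum (module_mat TYPE('a::comm_ring_1) nr nc) f F \<in> carrier_mat nr nc"
proof -
  interpret abelian_group "module_mat TYPE('a) nr nc"
    by (rule abelian_group_mat)
  show ?thesis
    using assms finsum_closed[of f F] by (simp add: module_mat_simps)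
qed

lemma index_finsum_module_mat:
  assumes "finite F" "f \<in> F \<rightarrow> carrier_mat nr nc" "i < nr" "j < nc"
  shows "finsum (module_mat TYPE('a::comm_ring_1) nr nc) f F $$ (i, j) = (\<Sum>s\<in>F. f s $$ (i, j))"
proof -
  interpret abelian_group "module_mat TYPE('a) nr nc"
    by (rule abelian_group_mat)
  show ?thesis
    using assms(1,2)
  proof (induction F)
    case empty
    then show ?case using assms by (simp add: module_mat_simps)
  next
    case (insert x F)
    have "finsum (module_mat TYPE('a) nr nc) f (insert x F) =
      f x + finsum (module_mat TYPE('a) nr nc) f F"
      using finsum_insert[of F x f] insert by (simp add: module_mat_simps Pi_iff)
    moreover have "f x \<in> carrier_mat nr nc" "finsum (module_mat TYPE('a) nr nc) f F \<in> carrier_mat nr nc"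
      using insert finsum_module_mat_closed[of f F] by auto
    ultimately show ?case
      using insert assms by auto
  qed
qed

subsection \<open>Codes from a simultaneously diagonalized family\<close>

lemma cyclic_perm_mat_carrier:
  assumes "0 < L"
  shows "cyclic_perm_mat L \<in> carrier_mat L L"
  using assms by (intro carrier_matI) (simp_all add: cyclic_perm_mat_def)

text \<open>Isolates what the distance argument rests on: over the extension field all shift
  matrices become diagonal in one common basis, with powers of fixed elements
  \<open>\<gamma> r\<close> as entries. Neither \<open>U\<close> nor the Vandermonde matrices
  appear.\<close>

locale shift_diagonalized = field_hom hom
  for hom :: "'a::{field,finite} \<Rightarrow> 'b::{field,finite}" +
  fixes L J :: nat and P Q :: "'a mat" and T Ti :: "'b mat" and \<gamma> :: "nat \<Rightarrow> 'b"
  assumes prime_card: "prime CARD('a)"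
    and P: "P \<in> carrier_mat J L" and Q: "Q \<in> carrier_mat L J"
    and L: "0 < L"
    and T: "T \<in> carrier_mat J J" and Ti: "Ti \<in> carrier_mat J J"
    and T_Ti: "T * Ti = 1\<^sub>m J" and Ti_T: "Ti * T = 1\<^sub>m J"
    and diagonalized: "map_mat hom (P * cyclic_perm_mat L ^\<^sub>m e * Q) =
      T * mat_diag J (\<lambda>r. \<gamma> r ^ e) * Ti"
begin

abbreviation shift_mat :: "nat \<Rightarrow> 'a mat" where
  "shift_mat e \<equiv> P * cyclic_perm_mat L ^\<^sub>m e * Q"

text \<open>
  Entry \<open>r\<close> of the row vector \<open>v T\<close>; in these coordinates every shift matrix acts diagonally.
\<close>

definition coord :: "nat \<Rightarrow> 'a vec \<Rightarrow> 'b" where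
  "coord r v = (\<Sum>c<J. T $$ (c, r) * hom (v $ c))"

text \<open>The \<open>r\<close>-th diagonal entry, after diagonalization by \<open>T\<close>, of
  the combination of the matrices \<open>shift_mat (l i)\<close> with coefficients
  \<open>a $ i\<close>. It is also the argument at which a codeword applied to \<open>a\<close>
  evaluates a \<open>q\<close>-polynomial in coordinate \<open>r\<close>.\<close>

definition point :: "nat \<Rightarrow> nat \<Rightarrow> (nat \<Rightarrow> nat) \<Rightarrow> 'a vec \<Rightarrow> 'b" where
  "point r n l a = (\<Sum>i<n. hom (a $ i) * \<gamma> r ^ l i)"

section \<open>Frobenius powers in the extension field\<close>

lemma CHAR_base: "CHAR('a) = CARD('a)"
  by (rule CHAR_eq_prime_card[OF prime_card])

lemma CHAR_ext: "CHAR('b) = CARD('a)"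
proof -
  have "of_nat CARD('a) = hom (of_nat CARD('a))"
    by (rule hom_of_nat[symmetric])
  also have "of_nat CARD('a) = (0 :: 'a)"
    using of_nat_CHAR[where 'a='a] by (simp add: CHAR_base)
  finally have "CHAR('b) dvd CARD('a)"
    by (simp add: of_nat_eq_0_iff_char_dvd)
  thus ?thesis
    using CHAR_not_1'[where 'a='b] prime_card by (auto simp: prime_nat_iff)
qed

lemma hom_frobenius: "hom x ^ (CARD('a) ^ s) = hom x"
proof (induction s)
  case (Suc s)
  have "hom x ^ CARD('a) ^ Suc s = (hom x ^ CARD('a) ^ s) ^ CARD('a)"
    by (simp only: power_Suc2 power_mult)
  also have "\<dots> = hom (x ^ CARD('a))"
    by (simp only: Suc hom_power)
  finally show ?case by (simp only: power_card_eq_same)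
qed simp

text \<open>Raising to the power \<open>CARD('a)\<close>, the characteristic, is additive and fixes
  the base field, so its iterates are linear over the base field.\<close>

lemma sum_frobenius:
  "(\<Sum>i\<in>A. hom (c i) * x i) ^ (CARD('a) ^ s) = (\<Sum>i\<in>A. hom (c i) * x i ^ (CARD('a) ^ s))"
proof -
  have "(\<Sum>i\<in>A. hom (c i) * x i) ^ (CARD('a) ^ s) = (\<Sum>i\<in>A. (hom (c i) * x i) ^ (CARD('a) ^ s))"
    by (rule freshmans_dream_sum'[where n = s]) (simp_all add: CHAR_ext prime_card)
  thus ?thesis by (simp add: power_mult_distrib hom_frobenius)
qed

lemma shift_mat_carrier [simp]: "shift_mat e \<in> carrier_mat J J"
  by (rule mult_carrier_mat[OF mult_carrier_mat[OF P pow_carrier_mat] Q])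
    (rule cyclic_perm_mat_carrier[OF L])

text \<open>The columns of \<open>T\<close> are eigenvectors of the shift matrices, and
  \<open>coord r\<close> pairs a row vector with the \<open>r\<close>-th such column.\<close>

lemma coord_shift:
  assumes r: "r < J" and v: "v \<in> carrier_vec J"
  shows "coord r (transpose_mat (shift_mat e) *\<^sub>v v) = \<gamma> r ^ e * coord r v"
proof -
  define M where "M = shift_mat e"
  have M: "M \<in> carrier_mat J J"
    unfolding M_def by simp
  have "map_mat hom M * T = T * mat_diag J (\<lambda>r. \<gamma> r ^ e) * (Ti * T)"
    unfolding diagonalized M_def using T Ti by (subst assoc_mult_mat[of _ J J _ J _ J]) auto
  also have "\<dots> = T * mat_diag J (\<lambda>r. \<gamma> r ^ e)"
    using T by (simp add: Ti_T right_mult_one_mat[of _ J J])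
  finally have MT: "map_mat hom M * T = T * mat_diag J (\<lambda>r. \<gamma> r ^ e)" .
  have entry: "(\<Sum>c<J. hom (M $$ (d, c)) * T $$ (c, r)) = T $$ (d, r) * \<gamma> r ^ e"
    if d: "d < J" for d
  proof -
    have "(map_mat hom M * T) $$ (d, r) = (\<Sum>c<J. hom (M $$ (d, c)) * T $$ (c, r))"
      using d r T M by (subst index_mult_mat_eq_sum[of _ J J _ J]) auto
    moreover have "(T * mat_diag J (\<lambda>r. \<gamma> r ^ e)) $$ (d, r) = T $$ (d, r) * \<gamma> r ^ e"
      using d r T by (simp add: mat_diag_mult_right[of _ J])
    ultimately show ?thesis unfolding MT by simp
  qed
  have "coord r (transpose_mat M *\<^sub>v v) =
    (\<Sum>c<J. T $$ (c, r) * hom (\<Sum>d<J. M $$ (d, c) * v $ d))"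
    unfolding coord_def using v M
    by (intro sum.cong refl, subst index_mult_mat_vec_eq_sum[of _ J J]) auto
  also have "\<dots> = (\<Sum>c<J. \<Sum>d<J. hom (v $ d) * (hom (M $$ (d, c)) * T $$ (c, r)))"
    by (simp add: hom_sum hom_mult sum_distrib_left mult_ac)
  also have "\<dots> = (\<Sum>d<J. hom (v $ d) * (\<Sum>c<J. hom (M $$ (d, c)) * T $$ (c, r)))"
    by (subst sum.swap) (simp add: sum_distrib_left)
  also have "\<dots> = \<gamma> r ^ e * coord r v"
    unfolding coord_def sum_distrib_left[of "\<gamma> r ^ e"]
    by (intro sum.cong refl) (simp add: entry)
  finally show ?thesis unfolding M_def .
qed

text \<open>Since \<open>T * Ti\<close> is the identity, multiplying the coordinates by
  \<open>Ti\<close> recovers the entries of \<open>v\<close>.\<close>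

lemma coord_eq_0_imp:
  assumes v: "v \<in> carrier_vec J" and 0: "\<And>r. r < J \<Longrightarrow> coord r v = 0"
  shows "v = 0\<^sub>v J"
proof (rule eq_vecI)
  fix d assume "d < dim_vec (0\<^sub>v J :: 'a vec)"
  hence d: "d < J" by simp
  have "(\<Sum>r<J. T $$ (c, r) * Ti $$ (r, d)) = (if c = d then 1 else 0)" if "c < J" for c
    using arg_cong[OF T_Ti, of "\<lambda>M. M $$ (c, d)"] that d T Ti
    by (auto simp: scalar_prod_def atLeast0LessThan)
  hence "hom (v $ d) = (\<Sum>c<J. hom (v $ c) * (\<Sum>r<J. T $$ (c, r) * Ti $$ (r, d)))"
    using d by (simp add: if_distrib[of "\<lambda>x. _ * x"] cong: if_cong)
  also have "\<dots> = (\<Sum>c<J. \<Sum>r<J. T $$ (c, r) * hom (v $ c) * Ti $$ (r, d))"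
    by (simp add: sum_distrib_left mult_ac)
  also have "\<dots> = (\<Sum>r<J. coord r v * Ti $$ (r, d))"
    unfolding coord_def by (subst sum.swap) (simp add: sum_distrib_right)
  finally show "v $ d = 0\<^sub>v J $ d"
    using 0 d by simp
qed (use v in simp)

section \<open>Codewords as evaluations of \<open>q\<close>-polynomials\<close>

lemma codeword_carrier [simp]: "circ_shift_codeword L J n k P Q l msg \<in> carrier_mat J n"
  unfolding circ_shift_codeword_def by (intro carrier_matI) simp_all

lemma codeword_index:
  assumes "b < J" "i < n" "\<And>s. s < k \<Longrightarrow> msg s \<in> carrier_vec J"
  shows "circ_shift_codeword L J n k P Q l msg $$ (b, i) =
    (\<Sum>s<k. (transpose_mat (shift_mat (CARD('a) ^ s * l i)) *\<^sub>v msg s) $ b)"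
proof -
  have "transpose_mat (shift_mat e) *\<^sub>v msg s \<in> carrier_vec J" if "s < k" for s e
    using assms(3)[OF that] by (intro mult_mat_vec_carrier[of _ J J]) simp_all
  thus ?thesis
    unfolding circ_shift_codeword_def using assms(1,2)
    by (simp add: mat_of_cols_index index_finsum_vec Pi_iff del: index_mult_mat_vec)
qed

text \<open>The shift exponents \<open>CARD('a) ^ s * l i\<close> make the \<open>s\<close>-th term
  a Frobenius power of the one with exponent \<open>l i\<close>. Hence in each coordinate the
  codeword acts as a linearized polynomial whose coefficients are coordinates of the
  message.\<close>

lemma coord_codeword:
  assumes r: "r < J" and msg: "\<And>s. s < k \<Longrightarrow> msg s \<in> carrier_vec J" and a: "a \<in> carrier_vec n"
  shows "coord r (circ_shift_codeword L J n k P Q l msg *\<^sub>v a) =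
    (\<Sum>s<k. coord r (msg s) * point r n l a ^ (CARD('a) ^ s))"
proof -
  let ?W = "circ_shift_codeword L J n k P Q l msg"
  let ?c = "\<lambda>s i. transpose_mat (shift_mat (CARD('a) ^ s * l i)) *\<^sub>v msg s"
  have pow: "\<gamma> r ^ (CARD('a) ^ s * l i) = (\<gamma> r ^ l i) ^ (CARD('a) ^ s)" for s i
    by (subst mult.commute) (rule power_mult)
  have shift: "hom (a $ i) * coord r (?c s i) =
      coord r (msg s) * (hom (a $ i) * (\<gamma> r ^ l i) ^ (CARD('a) ^ s))" if "s < k" for s i
    unfolding coord_shift[OF r msg[OF that]] pow by (simp only: mult_ac)
  have "(?W *\<^sub>v a) $ b = (\<Sum>i<n. \<Sum>s<k. a $ i * ?c s i $ b)" if "b < J" for b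
  proof -
    have "(?W *\<^sub>v a) $ b = (\<Sum>i<n. ?W $$ (b, i) * a $ i)"
      using that a by (intro index_mult_mat_vec_eq_sum) simp_all
    also have "\<dots> = (\<Sum>i<n. (\<Sum>s<k. ?c s i $ b) * a $ i)"
      using that msg by (intro sum.cong refl) (simp only: codeword_index lessThan_iff)
    finally show ?thesis
      by (simp only: sum_distrib_right mult.commute[of "a $ _"])
  qed
  hence "coord r (?W *\<^sub>v a) = (\<Sum>b<J. T $$ (b, r) * hom (\<Sum>i<n. \<Sum>s<k. a $ i * ?c s i $ b))"
    unfolding coord_def by (intro sum.cong refl) simp
  also have "\<dots> = (\<Sum>b<J. \<Sum>i<n. \<Sum>s<k. T $$ (b, r) * (hom (a $ i) * hom (?c s i $ b)))"
    by (simp only: hom_sum hom_mult sum_distrib_left)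
  also have "\<dots> = (\<Sum>i<n. \<Sum>s<k. \<Sum>b<J. T $$ (b, r) * (hom (a $ i) * hom (?c s i $ b)))"
    by (subst sum.swap) (intro sum.cong refl sum.swap)
  also have "\<dots> = (\<Sum>i<n. \<Sum>s<k. hom (a $ i) * coord r (?c s i))"
    unfolding coord_def sum_distrib_left by (intro sum.cong refl mult.left_commute)
  also have "\<dots> = (\<Sum>i<n. \<Sum>s<k. coord r (msg s) * (hom (a $ i) * (\<gamma> r ^ l i) ^ (CARD('a) ^ s)))"
    by (intro sum.cong refl shift) simp
  \<comment> \<open>By linearity of the Frobenius powers over the base field, the inner sum over
    \<open>i\<close> is a power of \<open>point r n l a\<close>.\<close>
  also have "\<dots> = (\<Sum>s<k. coord r (msg s) * point r n l a ^ (CARD('a) ^ s))"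
    unfolding point_def sum_frobenius sum_distrib_left by (rule sum.swap)
  finally show ?thesis .
qed

section \<open>The full rank condition in coordinates\<close>

lemma index_diagonalized:
  assumes "b < J" "c < J"
  shows "(T * mat_diag J d * Ti) $$ (b, c) = (\<Sum>r<J. T $$ (b, r) * d r * Ti $$ (r, c))"
proof -
  have "T * mat_diag J d = mat J J (\<lambda>(i, j). T $$ (i, j) * d j)"
    using T by (rule mat_diag_mult_right)
  thus ?thesis
    using assms Ti by (subst index_mult_mat_eq_sum[of _ J J _ J]) auto
qed

text \<open>The combination with coefficients \<open>a\<close> is similar to the diagonal matrix of
  the values \<open>point r n l a\<close>, so its determinant is their product. Testing the
  determinant in the extension field is sound because \<open>hom\<close> is injective.\<close>

lemma full_rank_combinations_iff:
  "full_rank_combinations L J n P Q l \<longleftrightarrow>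
    (\<forall>a\<in>carrier_vec n. a \<noteq> 0\<^sub>v n \<longrightarrow> (\<forall>r<J. point r n l a \<noteq> 0))"
proof -
  have "mat_rank (finsum (module_mat TYPE('a) J J) (\<lambda>i. (a $ i) \<cdot>\<^sub>m shift_mat (l i)) {..<n}) = J \<longleftrightarrow>
    (\<forall>r<J. point r n l a \<noteq> 0)" for a
  proof -
    define S where "S = finsum (module_mat TYPE('a) J J) (\<lambda>i. (a $ i) \<cdot>\<^sub>m shift_mat (l i)) {..<n}"
    have carr: "(\<lambda>i. (a $ i) \<cdot>\<^sub>m shift_mat (l i)) \<in> {..<n} \<rightarrow> carrier_mat J J"
      by (intro Pi_I smult_carrier_mat shift_mat_carrier)
    have S: "S \<in> carrier_mat J J"
      unfolding S_def by (rule finsum_module_mat_closed[OF carr])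
    have "map_mat hom S = T * mat_diag J (\<lambda>r. point r n l a) * Ti"
    proof (rule eq_matI)
      fix b c assume "b < dim_row (T * mat_diag J (\<lambda>r. point r n l a) * Ti)"
        "c < dim_col (T * mat_diag J (\<lambda>r. point r n l a) * Ti)"
      hence bc: "b < J" "c < J" using T Ti by auto
      have ent: "hom (shift_mat e $$ (b, c)) = (\<Sum>r<J. T $$ (b, r) * \<gamma> r ^ e * Ti $$ (r, c))" for e
        using bc index_diagonalized[OF bc, of "\<lambda>r. \<gamma> r ^ e"]
        unfolding diagonalized[symmetric] by (simp add: carrier_matD[OF P] carrier_matD[OF Q] del: index_mult_mat(1))
      have "S $$ (b, c) = (\<Sum>i<n. ((a $ i) \<cdot>\<^sub>m shift_mat (l i)) $$ (b, c))"
        unfolding S_def by (rule index_finsum_module_mat[OF _ carr bc]) simp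
      also have "\<dots> = (\<Sum>i<n. a $ i * shift_mat (l i) $$ (b, c))"
        using bc by (intro sum.cong refl index_smult_mat(1)) (simp_all add: carrier_matD[OF P] carrier_matD[OF Q])
      finally have "hom (S $$ (b, c)) = (\<Sum>i<n. \<Sum>r<J. hom (a $ i) * (T $$ (b, r) * \<gamma> r ^ l i * Ti $$ (r, c)))"
        by (simp only: hom_sum hom_mult ent sum_distrib_left)
      also have "\<dots> = (\<Sum>r<J. T $$ (b, r) * point r n l a * Ti $$ (r, c))"
        unfolding point_def sum_distrib_left sum_distrib_right
        by (subst sum.swap) (intro sum.cong refl, simp only: mult_ac)
      finally show "map_mat hom S $$ (b, c) = (T * mat_diag J (\<lambda>r. point r n l a) * Ti) $$ (b, c)"
        using S bc by (simp add: index_diagonalized del: index_mult_mat(1))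
    qed (use S T Ti in auto)
    hence "hom (det S) = det (T * mat_diag J (\<lambda>r. point r n l a) * Ti)"
      using hom_det[of S] by simp
    also have "\<dots> = det T * det (mat_diag J (\<lambda>r. point r n l a)) * det Ti"
      using T Ti by (simp add: det_mult[of _ J])
    also have "\<dots> = det (mat_diag J (\<lambda>r. point r n l a)) * det (T * Ti)"
      using T Ti by (simp add: det_mult[of _ J])
    also have "\<dots> = (\<Prod>r<J. point r n l a)"
      by (subst det_upper_triangular[of _ J])
        (auto simp: T_Ti mat_diag_def upper_triangular_def diag_mat_def prod.list_conv_set_nth
          atLeast0LessThan)
    finally have eq: "hom (det S) = (\<Prod>r<J. point r n l a)" .
    have "det S \<noteq> 0 \<longleftrightarrow> hom (det S) \<noteq> 0"
      by simp
    hence "det S \<noteq> 0 \<longleftrightarrow> (\<forall>r<J. point r n l a \<noteq> 0)"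
      unfolding eq by auto
    thus ?thesis
      using mat_rank_eq_iff_det[OF S] unfolding S_def by simp
  qed
  thus ?thesis unfolding full_rank_combinations_def by simp
qed

text \<open>\<open>point\<close> respects differences, and the full rank condition leaves it no
  nonzero kernel vector.\<close>

lemma inj_on_point:
  assumes "full_rank_combinations L J n P Q l" and r: "r < J"
  shows "inj_on (point r n l) (carrier_vec n)"
proof (rule inj_onI)
  fix a a' :: "'a vec" assume a: "a \<in> carrier_vec n" "a' \<in> carrier_vec n" "point r n l a = point r n l a'"
  have "point r n l (a - a') = point r n l a - point r n l a'"
    unfolding point_def sum_subtractf[symmetric]
    using a(1,2) by (intro sum.cong refl) (simp add: hom_minus algebra_simps)
  hence "a - a' = 0\<^sub>v n"
    using assms a unfolding full_rank_combinations_iff by auto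
  thus "a = a'"
    by (rule eq_vec_if_minus_eq_zero[OF a(1,2)])
qed

section \<open>Rank of codewords and injectivity of the encoding\<close>

lemma card_kernel_codeword_le:
  assumes full: "full_rank_combinations L J n P Q l"
    and msg: "\<And>s. s < k \<Longrightarrow> msg s \<in> carrier_vec J" and s0: "s0 < k" "msg s0 \<noteq> 0\<^sub>v J"
  shows "card {a \<in> carrier_vec n. circ_shift_codeword L J n k P Q l msg *\<^sub>v a = 0\<^sub>v J} \<le> CARD('a) ^ (k - 1)"
    (is "card ?K \<le> _")
proof -
  \<comment> \<open>A nonzero message vector has a nonzero coordinate; this choice of
    \<open>r\<close> makes the polynomial \<open>p\<close> nonzero.\<close>
  obtain r where r: "r < J" "coord r (msg s0) \<noteq> 0"
    using coord_eq_0_imp[OF msg[OF s0(1)]] s0(2) by blast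
  define p where "p = (\<Sum>s<k. monom (coord r (msg s)) (CARD('a) ^ s))"
  have card1: "1 < CARD('a)"
    using prime_card prime_gt_1_nat by blast
  \<comment> \<open>The exponents \<open>CARD('a) ^ s\<close> are distinct because the base is
    larger than 1, so no other monomial contributes to this coefficient.\<close>
  have "coeff p (CARD('a) ^ s0) = (\<Sum>s<k. if s = s0 then coord r (msg s) else 0)"
    unfolding p_def coeff_sum coeff_monom using card1 by (intro sum.cong refl) auto
  also have "\<dots> \<noteq> 0" using r s0 by simp
  finally have p0: "p \<noteq> 0" by auto
  have deg: "degree p \<le> CARD('a) ^ (k - 1)"
    unfolding p_def
  proof (rule degree_sum_le)
    fix s assume "s \<in> {..<k}"
    hence "CARD('a) ^ s \<le> CARD('a) ^ (k - 1)"
      using card1 by (intro power_increasing) auto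
    thus "degree (monom (coord r (msg s)) (CARD('a) ^ s)) \<le> CARD('a) ^ (k - 1)"
      using degree_monom_le order_trans by blast
  qed simp
  have "point r n l ` ?K \<subseteq> {x. poly p x = 0}"
  proof
    fix x assume "x \<in> point r n l ` ?K"
    then obtain a where a: "a \<in> carrier_vec n" "circ_shift_codeword L J n k P Q l msg *\<^sub>v a = 0\<^sub>v J"
      "x = point r n l a" by auto
    have "poly p x = coord r (circ_shift_codeword L J n k P Q l msg *\<^sub>v a)"
      using coord_codeword[of r k msg a n l, OF r(1) msg a(1)]
      by (simp add: p_def poly_sum poly_monom a(3))
    also have "\<dots> = 0" unfolding a(2) coord_def by simp
    finally show "x \<in> {x. poly p x = 0}" by simp
  qed
  moreover have "inj_on (point r n l) ?K"
    by (rule inj_on_subset[OF inj_on_point[OF full r(1)]]) auto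
  ultimately have "card ?K \<le> card {x. poly p x = 0}"
    using poly_roots_finite[OF p0] by (intro card_inj_on_le)
  also have "\<dots> \<le> CARD('a) ^ (k - 1)"
    using card_poly_roots_bound[OF p0] deg by simp
  finally show ?thesis .
qed

text \<open>Counting: kernel size times image size is at least \<open>CARD('a) ^ n\<close>, the
  kernel has at most \<open>CARD('a) ^ (k - 1)\<close> elements, and the rank bounds the
  image.\<close>

lemma mat_rank_codeword_ge:
  assumes full: "full_rank_combinations L J n P Q l" and kn: "k \<le> n"
    and msg: "\<And>s. s < k \<Longrightarrow> msg s \<in> carrier_vec J" and s0: "s0 < k" "msg s0 \<noteq> 0\<^sub>v J"
  shows "n - k + 1 \<le> mat_rank (circ_shift_codeword L J n k P Q l msg)"
proof -
  let ?W = "circ_shift_codeword L J n k P Q l msg"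
  have W: "?W \<in> carrier_mat J n" by simp
  have "CARD('a) ^ n \<le> card {a \<in> carrier_vec n. ?W *\<^sub>v a = 0\<^sub>v J} * card ((*\<^sub>v) ?W ` carrier_vec n)"
    using card_carrier_vec_le_kernel_image[OF W] by (simp add: card_carrier_vec)
  also have "\<dots> \<le> CARD('a) ^ (k - 1) * CARD('a) ^ mat_rank ?W"
    using card_kernel_codeword_le[of n l k msg s0, OF full msg s0] card_mult_mat_vec_image_le[OF W] by (rule mult_le_mono)
  finally have "CARD('a) ^ n \<le> CARD('a) ^ (k - 1 + mat_rank ?W)"
    by (simp add: power_add)
  hence "n \<le> k - 1 + mat_rank ?W"
    using prime_gt_1_nat[OF prime_card] by (simp only: power_increasing_iff)
  thus ?thesis using s0(1) kn by linarith
qed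

text \<open>Linearity of the encoding reduces distances between codewords to ranks of single
  codewords.\<close>

lemma codeword_diff:
  assumes "\<And>s. s < k \<Longrightarrow> msg s \<in> carrier_vec J" "\<And>s. s < k \<Longrightarrow> msg' s \<in> carrier_vec J"
  shows "circ_shift_codeword L J n k P Q l msg - circ_shift_codeword L J n k P Q l msg' =
    circ_shift_codeword L J n k P Q l (\<lambda>s. msg s - msg' s)" (is "?W - ?W' = ?D")
proof (rule eq_matI)
  have carr: "?W \<in> carrier_mat J n" "?W' \<in> carrier_mat J n" "?D \<in> carrier_mat J n" by simp_all
  fix b i assume "b < dim_row ?D" "i < dim_col ?D"
  hence bi: "b < J" "i < n" using carr by auto
  have "(transpose_mat (shift_mat e) *\<^sub>v (msg s - msg' s)) $ b =
    (transpose_mat (shift_mat e) *\<^sub>v msg s) $ b - (transpose_mat (shift_mat e) *\<^sub>v msg' s) $ b"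
    if "s < k" for s e
  proof -
    have "transpose_mat (shift_mat e) \<in> carrier_mat J J" by simp
    thus ?thesis
      using assms[OF that] bi(1)
      by (simp add: mult_minus_distrib_mat_vec[of _ J J] del: index_mult_mat_vec)
        (subst index_minus_vec(1), simp_all add: carrier_matD[OF Q])
  qed
  thus "(?W - ?W') $$ (b, i) = ?D $$ (b, i)"
    using bi carr assms
    by (simp add: codeword_index sum_subtractf[symmetric] carrier_matD[OF carr(2)] del: index_mult_mat_vec)
qed (simp_all add: carrier_matD[OF codeword_carrier])

text \<open>Only the first \<open>k\<close> message vectors matter. Extensional messages form a
  finite set on which the encoding can be injective, which makes the code countable by its
  messages.\<close>

lemma circ_shift_code_eq_image:
  "circ_shift_code L J n k P Q l =
    circ_shift_codeword L J n k P Q l ` ({..<k} \<rightarrow>\<^sub>E carrier_vec J)"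
proof -
  have "circ_shift_codeword L J n k P Q l msg = circ_shift_codeword L J n k P Q l (restrict msg {..<k})"
    if "\<forall>s<k. msg s \<in> carrier_vec J" for msg
    using that by (intro eq_matI) (simp_all add: carrier_matD[OF codeword_carrier] codeword_index
        del: index_mult_mat_vec)
  note restrict = this
  show ?thesis
  proof (intro equalityI subsetI)
    fix A assume "A \<in> circ_shift_code L J n k P Q l"
    then obtain msg where msg: "A = circ_shift_codeword L J n k P Q l msg" "\<forall>s<k. msg s \<in> carrier_vec J"
      unfolding circ_shift_code_def by blast
    show "A \<in> circ_shift_codeword L J n k P Q l ` ({..<k} \<rightarrow>\<^sub>E carrier_vec J)"
      using msg(2) unfolding msg(1) restrict[OF msg(2)] by (intro imageI) auto
  qed (auto simp: circ_shift_code_def)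
qed

lemma mat_rank_code_diff_ge:
  assumes full: "full_rank_combinations L J n P Q l" and kn: "k \<le> n"
    and msg: "msg \<in> {..<k} \<rightarrow>\<^sub>E carrier_vec J" "msg' \<in> {..<k} \<rightarrow>\<^sub>E carrier_vec J" "msg \<noteq> msg'"
  shows "n - k + 1 \<le> mat_rank (circ_shift_codeword L J n k P Q l msg - circ_shift_codeword L J n k P Q l msg')"
proof -
  obtain s0 where s0: "s0 < k" "msg s0 \<noteq> msg' s0"
    using msg PiE_ext[of msg "{..<k}" _ msg'] by blast
  have carr: "msg s \<in> carrier_vec J" "msg' s \<in> carrier_vec J" if "s < k" for s
    using msg(1,2) that by auto
  have "msg s0 - msg' s0 \<noteq> 0\<^sub>v J"
  proof
    assume eq: "msg s0 - msg' s0 = 0\<^sub>v J"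
    have "msg s0 = msg' s0"
      by (rule eq_vec_if_minus_eq_zero[OF carr[OF s0(1)] eq])
    thus False using s0(2) by simp
  qed
  moreover have "circ_shift_codeword L J n k P Q l msg - circ_shift_codeword L J n k P Q l msg' =
      circ_shift_codeword L J n k P Q l (\<lambda>s. msg s - msg' s)"
    using carr by (rule codeword_diff)
  ultimately show ?thesis
    using mat_rank_codeword_ge[OF full kn, of "\<lambda>s. msg s - msg' s" s0] s0(1) carr by simp
qed

text \<open>Distinct messages with equal codewords would force the zero matrix to have rank at least
  \<open>n - k + 1\<close>, which is positive.\<close>

lemma inj_on_codeword:
  assumes full: "full_rank_combinations L J n P Q l" and kn: "k \<le> n"
  shows "inj_on (circ_shift_codeword L J n k P Q l) ({..<k} \<rightarrow>\<^sub>E carrier_vec J)"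
proof (rule inj_onI, rule ccontr)
  fix msg msg' assume *: "msg \<in> {..<k} \<rightarrow>\<^sub>E carrier_vec J" "msg' \<in> {..<k} \<rightarrow>\<^sub>E carrier_vec J"
    "circ_shift_codeword L J n k P Q l msg = circ_shift_codeword L J n k P Q l msg'" "msg \<noteq> msg'"
  have "mat_rank (0\<^sub>m J n :: 'a mat) \<le> n - n"
    by (rule mat_rank_le_if_zero_cols[of _ J]) simp_all
  moreover have "circ_shift_codeword L J n k P Q l msg - circ_shift_codeword L J n k P Q l msg' = 0\<^sub>m J n"
    unfolding *(3) using codeword_carrier by (rule minus_r_inv_mat)
  ultimately show False
    using mat_rank_code_diff_ge[OF full kn *(1,2,4)] by simp
qed

section \<open>Size of the code, Singleton bound and the MRD property\<close>

lemma card_circ_shift_code: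
  assumes "full_rank_combinations L J n P Q l" and "k \<le> n"
  shows "card (circ_shift_code L J n k P Q l) = CARD('a) ^ (J * k)"
  unfolding circ_shift_code_eq_image card_image[OF inj_on_codeword[OF assms]]
  by (simp add: card_PiE card_carrier_vec power_mult)

text \<open>
  The Singleton bound: two distinct codewords agree in the first \<open>k - 1\<close> columns, since the code
  has more than \<open>CARD('a) ^ (J * (k - 1))\<close> elements.
\<close>

lemma ex_codewords_rank_le:
  assumes full: "full_rank_combinations L J n P Q l" and "0 < J" "1 \<le> k" "k \<le> n"
  shows "\<exists>A\<in>circ_shift_code L J n k P Q l. \<exists>B\<in>circ_shift_code L J n k P Q l.
    A \<noteq> B \<and> mat_rank (A - B) \<le> n - k + 1"
proof -
  let ?C = "circ_shift_code L J n k P Q l"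
  let ?f = "\<lambda>A :: 'a mat. restrict (($$) A) ({..<J} \<times> {..<k - 1})"
  have "card (?f ` ?C) \<le> card (({..<J} \<times> {..<k - 1}) \<rightarrow>\<^sub>E (UNIV :: 'a set))"
    by (intro card_mono finite_PiE image_subsetI restrict_PiE) auto
  also have "\<dots> = CARD('a) ^ (J * (k - 1))"
    by (simp add: card_PiE card_cartesian_product)
  also have "\<dots> < CARD('a) ^ (J * k)"
    using prime_gt_1_nat[OF prime_card] assms(2,3) by (intro power_strict_increasing) auto
  also have "\<dots> = card ?C"
    by (rule card_circ_shift_code[OF full assms(4), symmetric])
  finally have "\<not> inj_on ?f ?C"
    by (rule pigeonhole)
  then obtain A B where AB: "A \<in> ?C" "B \<in> ?C" "A \<noteq> B" "?f A = ?f B"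
    unfolding inj_on_def by blast
  have carr: "A \<in> carrier_mat J n" "B \<in> carrier_mat J n"
    using AB(1,2) by (auto simp: circ_shift_code_def)
  have "(A - B) $$ (i, j) = 0" if "i < J" "j < k - 1" for i j
    using fun_cong[OF AB(4), of "(i, j)"] that assms(4) carr by auto
  hence "mat_rank (A - B) \<le> n - (k - 1)"
    using carr assms(4) by (intro mat_rank_le_if_zero_cols[of _ J n]) auto
  thus ?thesis using AB assms(3,4) by (intro bexI[of _ A] bexI[of _ B]) auto
qed

theorem is_MRD_circ_shift_code:
  assumes full: "full_rank_combinations L J n P Q l" and "0 < J" "1 \<le> k" "k \<le> n" "n \<le> J"
  shows "is_MRD_code J n (CARD('a) ^ (J * k)) (n - k + 1) (circ_shift_code L J n k P Q l)"
proof -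
  let ?C = "circ_shift_code L J n k P Q l"
  let ?D = "{mat_rank (A - B) |A B. A \<in> ?C \<and> B \<in> ?C \<and> A \<noteq> B}"
  have fin: "finite ?C"
    unfolding circ_shift_code_eq_image by (intro finite_imageI finite_PiE) auto
  have ge: "n - k + 1 \<le> d" if "d \<in> ?D" for d
    using that mat_rank_code_diff_ge[OF full assms(4)] unfolding circ_shift_code_eq_image by blast
  obtain A B where AB: "A \<in> ?C" "B \<in> ?C" "A \<noteq> B" "mat_rank (A - B) \<le> n - k + 1"
    using ex_codewords_rank_le[OF assms(1-4)] by blast
  have "min_rank_dist ?C = n - k + 1"
    unfolding min_rank_dist_def
  proof (rule Min_eqI)
    have "?D \<subseteq> (\<lambda>(A, B). mat_rank (A - B)) ` (?C \<times> ?C)" by auto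
    thus "finite ?D" using fin by (meson finite_SigmaI finite_imageI finite_subset)
    \<comment> \<open>The Singleton pair has distance at most \<open>n - k + 1\<close>, hence
      exactly this value, so the lower bound is attained.\<close>
    have "mat_rank (A - B) \<in> ?D" using AB by blast
    thus "n - k + 1 \<in> ?D" using ge[of "mat_rank (A - B)"] AB(4) by simp
  qed (rule ge)
  \<comment> \<open>With \<open>d = n - k + 1\<close> the MRD exponent
    \<open>J * (n - d + 1)\<close> becomes \<open>J * k\<close>.\<close>
  moreover have "n - (n - k + 1) + 1 = k" using assms by simp
  moreover have "?C \<subseteq> carrier_mat J n" by (auto simp: circ_shift_code_def)
  ultimately show ?thesis
    unfolding is_MRD_code_def using assms card_circ_shift_code[OF full assms(4)] by simp
qed

end

subsection \<open>Roots of unity and the shift matrix\<close>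

text \<open>Exponents reduce modulo \<open>L\<close>; equal powers for two distinct residues would
  give a positive exponent below \<open>L\<close> with power 1.\<close>

lemma primitive_root_power_eq_iff:
  assumes "primitive_root_of_unity L \<beta>"
  shows "\<beta> ^ i = \<beta> ^ j \<longleftrightarrow> [i = j] (mod L)"
proof -
  have L: "0 < L" "\<beta> ^ L = 1" and prim: "\<And>i. 0 < i \<Longrightarrow> i < L \<Longrightarrow> \<beta> ^ i \<noteq> 1"
    using assms by (auto simp: primitive_root_of_unity_def)
  have nz: "\<beta> \<noteq> 0"
    using L by (auto simp: power_0_left)
  have "\<beta> ^ i = \<beta> ^ (L * (i div L) + i mod L)" for i
    by simp
  hence red: "\<beta> ^ i = \<beta> ^ (i mod L)" for i
    unfolding power_add power_mult L(2) by simp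
  have less: "\<beta> ^ a \<noteq> \<beta> ^ b" if "a < b" "b < L" for a b
  proof
    assume "\<beta> ^ a = \<beta> ^ b"
    moreover have "\<beta> ^ b = \<beta> ^ a * \<beta> ^ (b - a)"
      unfolding power_add[symmetric] using that by simp
    ultimately show False
      using nz prim[of "b - a"] that by simp
  qed
  have "i mod L < L" "j mod L < L" using L by simp_all
  hence "\<beta> ^ (i mod L) = \<beta> ^ (j mod L) \<longleftrightarrow> i mod L = j mod L"
    by (cases "i mod L" "j mod L" rule: linorder_cases) (auto dest: less less[symmetric])
  thus ?thesis
    unfolding cong_def using red[of i] red[of j] by simp
qed

lemma primitive_root_power:
  assumes "primitive_root_of_unity L \<beta>" "coprime p L"
  shows "primitive_root_of_unity L (\<beta> ^ p)"
proof -
  have "L dvd i" if "(\<beta> ^ p) ^ i = 1" for i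
  proof -
    have "\<beta> ^ (p * i) = \<beta> ^ 0" using that by (simp add: power_mult)
    hence "L dvd p * i"
      unfolding primitive_root_power_eq_iff[OF assms(1)] by (simp add: cong_0_iff)
    thus ?thesis
      using coprime_dvd_mult_right_iff[of L p i] coprime_commute[of p L] assms(2) by blast
  qed
  moreover have "(\<beta> ^ p) ^ L = 1"
    using assms(1) by (metis mult.commute power_mult power_one primitive_root_of_unity_def)
  ultimately show ?thesis
    using assms(1) nat_dvd_not_less unfolding primitive_root_of_unity_def by blast
qed

text \<open>Orthogonality relation behind the inversion of the Vandermonde matrix: a geometric sum
  whose ratio is an \<open>L\<close>-th root of unity vanishes unless the ratio is 1.\<close>

lemma sum_primitive_root_powers:
  fixes \<beta> :: "'a::field"
  assumes \<beta>: "primitive_root_of_unity L \<beta>" and "i < L" "j < L"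
  shows "(\<Sum>r<L. inverse \<beta> ^ (i * r) * \<beta> ^ (r * j)) = (if i = j then of_nat L else 0)"
proof -
  define x where "x = inverse \<beta> ^ i * \<beta> ^ j"
  have L: "0 < L" "\<beta> ^ L = 1"
    using \<beta> by (auto simp: primitive_root_of_unity_def)
  have nz: "\<beta> \<noteq> 0" using L by (auto simp: power_0_left)
  have "(\<Sum>r<L. inverse \<beta> ^ (i * r) * \<beta> ^ (r * j)) = (\<Sum>r<L. x ^ r)"
    by (intro sum.cong refl) (simp only: x_def power_mult_distrib power_mult[symmetric] mult.commute)
  also have "\<dots> = (if x = 1 then of_nat L else 0)"
  proof (cases "x = 1")
    case False
    have "(\<beta> ^ k) ^ L = 1" for k
      using L(2) by (metis mult.commute power_mult power_one)
    hence "x ^ L = 1"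
      by (simp add: x_def power_mult_distrib power_inverse)
    thus ?thesis using False geometric_sum[OF False, of L] by simp
  qed simp
  also have "x = 1 \<longleftrightarrow> \<beta> ^ j = \<beta> ^ i"
    unfolding x_def using nz by (simp add: power_inverse field_simps)
  also have "\<dots> \<longleftrightarrow> i = j"
    unfolding primitive_root_power_eq_iff[OF \<beta>] using assms(2,3) by (auto simp: cong_def)
  finally show ?thesis .
qed

lemma index_cyclic_perm_mat:
  assumes "i < L" "j < L"
  shows "cyclic_perm_mat L $$ (i, j) = (if j = Suc i mod L then 1 else 0)"
proof (cases "i < L - 1")
  case True
  hence "Suc i mod L = Suc i" by simp
  thus ?thesis using assms True by (auto simp: cyclic_perm_mat_def)
next
  case False
  hence "Suc i = L" using assms by simp
  thus ?thesis using assms by (auto simp: cyclic_perm_mat_def)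
qed

lemma (in field_hom) map_mat_cyclic_perm_mat:
  assumes "0 < L"
  shows "map_mat hom (cyclic_perm_mat L) = cyclic_perm_mat L"
proof (rule eq_matI)
  fix i j assume "i < dim_row (cyclic_perm_mat L :: 'b mat)" "j < dim_col (cyclic_perm_mat L :: 'b mat)"
  hence "i < L" "j < L"
    using cyclic_perm_mat_carrier[OF assms, where 'a='b] by (metis carrier_matD)+
  thus "map_mat hom (cyclic_perm_mat L) $$ (i, j) = cyclic_perm_mat L $$ (i, j)"
    using cyclic_perm_mat_carrier[OF assms, where 'a='a]
    by (subst index_map_mat(1)) (auto simp: index_cyclic_perm_mat)
qed (use cyclic_perm_mat_carrier[OF assms] in \<open>metis carrier_matD index_map_mat(2,3)\<close>)+

text \<open>One cyclic shift raises the row offset by 1. The offset \<open>k\<close> is arbitrary so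
  that the induction hypothesis applies to the matrix already shifted once.\<close>

lemma cyclic_perm_mat_pow_mult_vandermonde:
  fixes \<beta> :: "'a::field"
  assumes L: "0 < L" and \<beta>: "\<beta> ^ L = 1"
  shows "cyclic_perm_mat L ^\<^sub>m e * mat L L (\<lambda>(i, j). \<beta> ^ ((i + k) * j)) =
    mat L L (\<lambda>(i, j). \<beta> ^ ((i + k + e) * j))"
proof (induction e arbitrary: k)
  case 0
  have "dim_row (cyclic_perm_mat L :: 'a mat) = L"
    using cyclic_perm_mat_carrier[OF L] by (rule carrier_matD)
  thus ?case by simp
next
  case (Suc e)
  let ?C = "cyclic_perm_mat L :: 'a mat"
  let ?V = "\<lambda>k. mat L L (\<lambda>(i, j). \<beta> ^ ((i + k) * j))"
  have C: "?C \<in> carrier_mat L L"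
    by (rule cyclic_perm_mat_carrier[OF L])
  have "?C * ?V k = ?V (Suc k)"
  proof (rule eq_matI)
    fix i j assume "i < dim_row (?V (Suc k))" "j < dim_col (?V (Suc k))"
    hence ij: "i < L" "j < L" by auto
    have "(?C * ?V k) $$ (i, j) = (\<Sum>r<L. ?C $$ (i, r) * ?V k $$ (r, j))"
      using ij C by (intro index_mult_mat_eq_sum[of _ L L _ L]) auto
    also have "\<dots> = (\<Sum>r<L. if r = Suc i mod L then \<beta> ^ ((r + k) * j) else 0)"
      using ij by (intro sum.cong refl) (simp add: index_cyclic_perm_mat)
    also have "\<dots> = \<beta> ^ ((Suc i mod L + k) * j)"
      using L by simp
    \<comment> \<open>The wrap-around in the last row is absorbed by
      \<open>\<beta> ^ L = 1\<close>.\<close>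
    also have "\<dots> = \<beta> ^ ((Suc i + k) * j)"
    proof -
      have "\<beta> ^ Suc i = \<beta> ^ (L * (Suc i div L) + Suc i mod L)"
        by simp
      hence "\<beta> ^ Suc i = \<beta> ^ (Suc i mod L)"
        unfolding power_add power_mult \<beta> by simp
      thus ?thesis by (simp only: power_mult power_add)
    qed
    finally show "(?C * ?V k) $$ (i, j) = ?V (Suc k) $$ (i, j)"
      using ij by simp
  qed (use C in auto)
  moreover have "?C ^\<^sub>m Suc e * ?V k = ?C ^\<^sub>m e * (?C * ?V k)"
    using C by (simp add: assoc_mult_mat[of _ L L _ L _ L])
  ultimately show ?case
    using Suc[of "Suc k"] by simp
qed

text \<open>Splitting off the factor \<open>\<beta> ^ (e * j)\<close> leaves the orthogonality
  relation.\<close>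

lemma vandermonde_mult_shifted_vandermonde:
  fixes \<beta> :: "'a::field"
  assumes \<beta>: "primitive_root_of_unity L \<beta>"
  shows "vandermonde_mat L (inverse \<beta>) * mat L L (\<lambda>(i, j). \<beta> ^ ((i + e) * j)) =
    mat_diag L (\<lambda>j. of_nat L * \<beta> ^ (e * j))"
proof (rule eq_matI)
  fix i j assume "i < dim_row (mat_diag L (\<lambda>j. of_nat L * \<beta> ^ (e * j)))"
    "j < dim_col (mat_diag L (\<lambda>j. of_nat L * \<beta> ^ (e * j)))"
  hence ij: "i < L" "j < L" by (auto simp: mat_diag_def)
  have "(vandermonde_mat L (inverse \<beta>) * mat L L (\<lambda>(i, j). \<beta> ^ ((i + e) * j))) $$ (i, j) =
    (\<Sum>r<L. inverse \<beta> ^ (i * r) * \<beta> ^ ((r + e) * j))"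
    using ij by (subst index_mult_mat_eq_sum[of _ L L _ L]) (auto simp: vandermonde_mat_def)
  also have "\<dots> = (\<Sum>r<L. inverse \<beta> ^ (i * r) * \<beta> ^ (r * j)) * \<beta> ^ (e * j)"
    by (simp add: sum_distrib_right add_mult_distrib power_add mult.assoc)
  also have "\<dots> = mat_diag L (\<lambda>j. of_nat L * \<beta> ^ (e * j)) $$ (i, j)"
    unfolding sum_primitive_root_powers[OF \<beta> ij] using ij by (simp add: mat_diag_def)
  finally show "(vandermonde_mat L (inverse \<beta>) * mat L L (\<lambda>(i, j). \<beta> ^ ((i + e) * j))) $$ (i, j) =
    mat_diag L (\<lambda>j. of_nat L * \<beta> ^ (e * j)) $$ (i, j)" .
qed (simp_all add: mat_diag_def vandermonde_mat_def)

text \<open>Regrouping places the power of the shift matrix between the two Vandermonde matrices,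
  where it becomes diagonal. These are inverse only up to \<open>of_nat L\<close>, a factor that the
  scaling of \<open>U'\<close> compensates.\<close>

lemma (in field_hom) shift_mat_eigendecomposition:
  fixes U U' :: "'b mat"
  assumes \<beta>: "primitive_root_of_unity L \<beta>"
    and U: "U \<in> carrier_mat J L" and U': "U' \<in> carrier_mat J L"
    and P: "map_mat hom P = U * vandermonde_mat L (inverse \<beta>)"
    and Q: "map_mat hom Q = vandermonde_mat L \<beta> * transpose_mat U'"
  shows "map_mat hom (P * cyclic_perm_mat L ^\<^sub>m e * Q) =
    U * mat_diag L (\<lambda>j. of_nat L * \<beta> ^ (e * j)) * transpose_mat U'"
proof -
  have L: "0 < L" "\<beta> ^ L = 1"
    using \<beta> by (auto simp: primitive_root_of_unity_def)
  let ?V = "vandermonde_mat L \<beta>" and ?Vi = "vandermonde_mat L (inverse \<beta>)"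
  let ?C = "cyclic_perm_mat L :: 'b mat" and ?D = "mat_diag L (\<lambda>j. of_nat L * \<beta> ^ (e * j))"
  have V: "?V \<in> carrier_mat L L" "?Vi \<in> carrier_mat L L"
    by (simp_all add: vandermonde_mat_def)
  have C: "(cyclic_perm_mat L :: 'a mat) ^\<^sub>m e \<in> carrier_mat L L" "?C ^\<^sub>m e \<in> carrier_mat L L"
    by (intro pow_carrier_mat cyclic_perm_mat_carrier[OF L(1)])+
  have Ut: "transpose_mat U' \<in> carrier_mat L J" using U' by simp
  have PQ: "P \<in> carrier_mat J L" "Q \<in> carrier_mat L J"
    using arg_cong[OF P, of dim_row] arg_cong[OF P, of dim_col] arg_cong[OF Q, of dim_row]
      arg_cong[OF Q, of dim_col] U U' V by (auto intro!: carrier_matI)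
  have "map_mat hom (P * cyclic_perm_mat L ^\<^sub>m e * Q) =
    (U * ?Vi) * ?C ^\<^sub>m e * (?V * transpose_mat U')"
    unfolding mat_hom_mult[OF mult_carrier_mat[OF PQ(1) C(1)] PQ(2)] mat_hom_mult[OF PQ(1) C(1)] P Q
      mat_hom_pow[OF cyclic_perm_mat_carrier[OF L(1)]] map_mat_cyclic_perm_mat[OF L(1)] ..
  also have "\<dots> = (U * ?Vi) * ?C ^\<^sub>m e * ?V * transpose_mat U'"
    by (rule assoc_mult_mat[OF mult_carrier_mat[OF mult_carrier_mat[OF U V(2)] C(2)] V(1) Ut, symmetric])
  also have "\<dots> = U * (?Vi * (?C ^\<^sub>m e * ?V)) * transpose_mat U'"
    unfolding assoc_mult_mat[OF U V(2) C(2)] assoc_mult_mat[OF U mult_carrier_mat[OF V(2) C(2)] V(1)]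
      assoc_mult_mat[OF V(2) C(2) V(1)] ..
  also have "?C ^\<^sub>m e * ?V = mat L L (\<lambda>(i, j). \<beta> ^ ((i + e) * j))"
    using cyclic_perm_mat_pow_mult_vandermonde[OF L, of e 0] by (simp add: vandermonde_mat_def)
  also have "?Vi * \<dots> = ?D"
    by (rule vandermonde_mult_shifted_vandermonde[OF \<beta>])
  finally show ?thesis .
qed

section \<open>Selected columns and matrix inverses\<close>

lemma pick_bij_betw:
  assumes "finite S"
  shows "bij_betw (pick S) {..<card S} S"
proof (rule bij_betwI[where g = "\<lambda>j. card {a \<in> S. a < j}"])
  show "(\<lambda>j. card {a \<in> S. a < j}) \<in> S \<rightarrow> {..<card S}"
    using assms by (auto intro!: psubset_card_mono)
qed (auto simp: pick_in_set_le card_pick_le pick_card_in_set)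

lemma select_cols_carrier:
  assumes "A \<in> carrier_mat nr nc" "S \<subseteq> {..<nc}"
  shows "select_cols A S \<in> carrier_mat nr (card S)"
proof -
  have "{j. j < nc \<and> j \<in> S} = S" using assms(2) by auto
  thus ?thesis
    using carrier_matD[OF assms(1)]
    by (intro carrier_matI) (simp_all add: select_cols_def dim_submatrix)
qed

lemma index_select_cols:
  assumes "A \<in> carrier_mat nr nc" "S \<subseteq> {..<nc}" "i < nr" "j < card S"
  shows "select_cols A S $$ (i, j) = A $$ (i, pick S j)"
proof -
  have "{j. j < nc \<and> j \<in> S} = S" using assms(2) by auto
  thus ?thesis
    using assms(3,4) carrier_matD[OF assms(1)]
    by (simp add: select_cols_def submatrix_index pick_UNIV)
qed

lemma index_eq_zero_if_select_cols_eq_zero: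
  assumes A: "A \<in> carrier_mat nr nc" and S: "S \<subseteq> {..<nc}" and 0: "select_cols A S = 0\<^sub>m nr (card S)"
    and "i < nr" "j \<in> S"
  shows "A $$ (i, j) = 0"
proof -
  have "j \<in> pick S ` {..<card S}"
    using pick_bij_betw[of S] S assms(5) by (auto simp: bij_betw_def finite_subset)
  then obtain t where "t < card S" "j = pick S t" by auto
  thus ?thesis
    using index_select_cols[OF A S assms(4), of t] 0 assms(4) by simp
qed

text \<open>Full rank rules out the result \<open>None\<close>, so \<open>the\<close> yields a
  genuine inverse.\<close>

lemma mat_inverse_if_mat_rank_eq:
  assumes A: "A \<in> carrier_mat n n" and "mat_rank A = n"
  shows "A * the (mat_inverse A) = 1\<^sub>m n" "the (mat_inverse A) * A = 1\<^sub>m n"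
    "the (mat_inverse A) \<in> carrier_mat n n"
proof -
  have "det A \<noteq> 0"
    using mat_rank_eq_iff_det[OF A] assms(2) by simp
  hence "A \<in> Units (ring_mat TYPE('a) n ())"
    by (rule det_non_zero_imp_unit[OF A])
  then obtain B where "mat_inverse A = Some B"
    using mat_inverse(1)[OF A, of "()"] by (cases "mat_inverse A") auto
  thus "A * the (mat_inverse A) = 1\<^sub>m n" "the (mat_inverse A) * A = 1\<^sub>m n"
    "the (mat_inverse A) \<in> carrier_mat n n"
    using mat_inverse(2)[OF A] by auto
qed

section \<open>Consecutive shifts\<close>

lemma (in shift_diagonalized) hom_combination_powers_neq_zero:
  assumes x: "primitive_root_of_unity L x" and cop: "coprime CARD('a) L"
    and n: "n \<le> ord L CARD('a)" and a: "a \<in> carrier_vec n" "a \<noteq> 0\<^sub>v n"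
  shows "(\<Sum>i<n. hom (a $ i) * x ^ i) \<noteq> 0"
proof
  assume 0: "(\<Sum>i<n. hom (a $ i) * x ^ i) = 0"
  let ?m = "ord L CARD('a)"
  define p where "p = (\<Sum>i<n. monom (hom (a $ i)) i)"
  have coeff: "coeff p i = (if i < n then hom (a $ i) else 0)" for i
    unfolding p_def coeff_sum coeff_monom by simp
  obtain i where i: "i < n" "a $ i \<noteq> 0"
    using a by (metis carrier_vecD eq_vecI index_zero_vec)
  hence p0: "p \<noteq> 0" using coeff[of i] by auto
  have "degree p \<le> n - 1"
    by (rule degree_le) (auto simp: coeff)
  \<comment> \<open>The index \<open>i\<close> shows that \<open>n\<close> is positive, which makes
    the degree bound strict.\<close>
  with i(1) have deg: "degree p < n" by simp
  \<comment> \<open>The coefficients lie in the base field, so every Frobenius conjugate of the root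
    \<open>x\<close> is a root.\<close>
  have "poly p (x ^ (CARD('a) ^ t)) = 0" for t
  proof -
    have "poly p (x ^ (CARD('a) ^ t)) = (\<Sum>i<n. hom (a $ i) * (x ^ i) ^ (CARD('a) ^ t))"
      unfolding p_def poly_sum poly_monom by (intro sum.cong refl) (simp only: power_mult[symmetric] mult.commute)
    also have "\<dots> = (\<Sum>i<n. hom (a $ i) * x ^ i) ^ (CARD('a) ^ t)"
      by (rule sum_frobenius[symmetric])
    also have "\<dots> = 0" unfolding 0 by simp
    finally show ?thesis .
  qed
  hence "(\<lambda>t. x ^ (CARD('a) ^ t)) ` {..<?m} \<subseteq> {y. poly p y = 0}" by auto
  \<comment> \<open>Equal conjugates have exponents \<open>CARD('a) ^ t\<close> and
    \<open>CARD('a) ^ t'\<close> congruent modulo \<open>L\<close>, so \<open>t\<close> and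
    \<open>t'\<close> agree modulo the order \<open>?m\<close>; both are below it.\<close>
  moreover have "inj_on (\<lambda>t. x ^ (CARD('a) ^ t)) {..<?m}"
  proof (rule inj_onI)
    fix t t' assume "t \<in> {..<?m}" "t' \<in> {..<?m}" "x ^ (CARD('a) ^ t) = x ^ (CARD('a) ^ t')"
    moreover from this(3) have "[t = t'] (mod ?m)"
      unfolding primitive_root_power_eq_iff[OF x] using order_divides_expdiff[of L "CARD('a)"] cop
      by (simp add: coprime_commute)
    ultimately show "t = t'" by (simp add: cong_def)
  qed
  ultimately have "card {..<?m} \<le> card {y. poly p y = 0}"
    using poly_roots_finite[OF p0] by (intro card_inj_on_le)
  also have "\<dots> \<le> degree p"
    by (rule card_poly_roots_bound[OF p0])
  finally show False using deg n by simp
qed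

text \<open>Powers of \<open>\<gamma> r\<close> do not see reduction of the exponent modulo
  \<open>L\<close>, and the offset \<open>c\<close> contributes only a common nonzero factor, which
  leaves the exponents \<open>0\<close> to \<open>n - 1\<close>.\<close>

lemma (in shift_diagonalized) full_rank_combinations_consecutive:
  assumes \<gamma>: "\<And>r. r < J \<Longrightarrow> primitive_root_of_unity L (\<gamma> r)" and cop: "coprime CARD('a) L"
    and n: "n \<le> ord L CARD('a)"
  shows "full_rank_combinations L J n P Q (\<lambda>j. (j + c) mod L)"
  unfolding full_rank_combinations_iff
proof (intro ballI impI allI)
  fix a :: "'a vec" and r assume a: "a \<in> carrier_vec n" "a \<noteq> 0\<^sub>v n" and r: "r < J"
  have "\<gamma> r ^ ((i + c) mod L) = \<gamma> r ^ i * \<gamma> r ^ c" for i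
    unfolding power_add[symmetric] primitive_root_power_eq_iff[OF \<gamma>[OF r]] by simp
  hence "point r n (\<lambda>j. (j + c) mod L) a = (\<Sum>i<n. hom (a $ i) * \<gamma> r ^ i) * \<gamma> r ^ c"
    unfolding point_def by (simp add: sum_distrib_right mult.assoc)
  moreover have "\<gamma> r \<noteq> 0"
    using \<gamma>[OF r] by (auto simp: primitive_root_of_unity_def power_0_left)
  ultimately show "point r n (\<lambda>j. (j + c) mod L) a \<noteq> 0"
    using hom_combination_powers_neq_zero[OF \<gamma>[OF r] cop n a] by simp
qed

section \<open>From the hypotheses on \<open>U\<close> and \<open>U'\<close> to a diagonalized
  family\<close>

theorem theorem7:
  fixes q L m J n k :: nat
    and \<phi> :: "'a::{field,finite} \<Rightarrow> 'b::{field,finite}"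
    and \<beta> :: 'b
    and U U' :: "'b mat"
    and P Q :: "'a mat"
  assumes "prime q" and "0 < L" and "coprime q L"
    and "m = ord L q"
    and "J = card (coprime_indices L)"
    and "CARD('a) = q" and "CARD('b) = q ^ m" and "field_hom \<phi>"
    and "primitive_root_of_unity L \<beta>"
    and "U \<in> carrier_mat J L" and "U' \<in> carrier_mat J L"
    and "mat_rank (select_cols U (coprime_indices L)) = J"
    and "transpose_mat (select_cols U' (coprime_indices L)) =
           inverse (of_nat L) \<cdot>\<^sub>m the (mat_inverse (select_cols U (coprime_indices L)))"
    and "select_cols U ({..<L} - coprime_indices L) = 0\<^sub>m J (L - J) \<or>
         select_cols U' ({..<L} - coprime_indices L) = 0\<^sub>m J (L - J)"
    and "map_mat \<phi> P = U * vandermonde_mat L (inverse \<beta>)"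
    and "map_mat \<phi> Q = vandermonde_mat L \<beta> * transpose_mat U'"
    and "1 \<le> k" and "k \<le> n" and "n \<le> m" and "m \<le> J"
  shows "(\<forall>l. inj_on l {..<n} \<and> (\<forall>i<n. l i \<le> L - 1) \<and> full_rank_combinations L J n P Q l \<longrightarrow>
            is_MRD_code J n (q ^ (J * k)) (n - k + 1) (circ_shift_code L J n k P Q l)) \<and>
         (\<forall>c\<le>L - 1. full_rank_combinations L J n P Q (\<lambda>j. (j + c) mod L))"
proof -
  interpret hom: field_hom \<phi> by fact
  let ?S = "coprime_indices L"
  define T where "T = select_cols U ?S"
  define Ti where "Ti = the (mat_inverse T)"
  define \<gamma> where "\<gamma> r = \<beta> ^ pick ?S r" for r
  have S: "?S \<subseteq> {..<L}" using assms(2) by (auto simp: coprime_indices_def)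
  hence fin: "finite ?S" by (rule finite_subset) simp
  have pick: "bij_betw (pick ?S) {..<J} ?S"
    using pick_bij_betw[OF fin] assms(5) by simp
  \<comment> \<open>The characteristic divides the field size \<open>q ^ m\<close>, which is coprime
    to \<open>L\<close>.\<close>
  have L0: "of_nat L \<noteq> (0 :: 'b)"
  proof
    assume "of_nat L = (0 :: 'b)"
    hence "CHAR('b) dvd L" by (simp add: of_nat_eq_0_iff_char_dvd)
    moreover have "coprime (q ^ m) L" using assms(3) by simp
    ultimately have "is_unit CHAR('b)"
      using CHAR_dvd_CARD[where 'a='b] assms(7) by (metis coprime_common_divisor)
    thus False using CHAR_not_1'[where 'a='b] by simp
  qed
  have T: "T \<in> carrier_mat J J"
    using select_cols_carrier[OF assms(10) S] assms(5) by (simp add: T_def)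
  have rank: "mat_rank T = J" using assms(12) by (simp add: T_def)
  note inv = mat_inverse_if_mat_rank_eq[OF T rank, folded Ti_def]
  \<comment> \<open>The transpose in the hypothesis turns the selected columns of \<open>U'\<close>
    into scaled rows of \<open>Ti\<close>.\<close>
  have U'_entry: "U' $$ (b, pick ?S r) = inverse (of_nat L) * Ti $$ (r, b)" if "r < J" "b < J" for r b
  proof -
    have "select_cols U' ?S \<in> carrier_mat J J"
      using select_cols_carrier[OF assms(11) S] assms(5) by simp
    hence "transpose_mat (select_cols U' ?S) $$ (r, b) = U' $$ (b, pick ?S r)"
      using that index_select_cols[OF assms(11) S that(2), of r] assms(5) by simp
    thus ?thesis
      using that inv(3) unfolding assms(13) T_def[symmetric] Ti_def[symmetric] by simp
  qed
  \<comment> \<open>The product vanishes whichever of the two matrices is zero on these columns, so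
    both cases of the hypothesis are treated at once.\<close>
  have zero: "U $$ (a, j) * U' $$ (b, j) = 0" if "a < J" "b < J" "j \<in> {..<L} - ?S" for a b j
  proof -
    have card: "card ({..<L} - ?S) = L - J"
      using card_Diff_subset[OF fin S] assms(5) by simp
    show ?thesis
      using assms(14) index_eq_zero_if_select_cols_eq_zero[OF assms(10) Diff_subset _ that(1,3)]
        index_eq_zero_if_select_cols_eq_zero[OF assms(11) Diff_subset _ that(2,3)]
      unfolding card by auto
  qed
  have carrier: "P \<in> carrier_mat J L" "Q \<in> carrier_mat L J"
    using arg_cong[OF assms(15), of dim_row] arg_cong[OF assms(15), of dim_col]
      arg_cong[OF assms(16), of dim_row] arg_cong[OF assms(16), of dim_col] assms(10,11)
    by (auto simp: vandermonde_mat_def intro!: carrier_matI)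
  \<comment> \<open>In the sum over all \<open>L\<close> columns only the \<open>J\<close> coprime
    indices survive, and \<open>of_nat L\<close> cancels against the scaling of
    \<open>U'\<close>.\<close>
  have diag: "map_mat \<phi> (P * cyclic_perm_mat L ^\<^sub>m e * Q) = T * mat_diag J (\<lambda>r. \<gamma> r ^ e) * Ti" for e
    unfolding hom.shift_mat_eigendecomposition[OF assms(9,10,11,15,16)]
  proof (rule eq_matI)
    fix a b assume "a < dim_row (T * mat_diag J (\<lambda>r. \<gamma> r ^ e) * Ti)"
      "b < dim_col (T * mat_diag J (\<lambda>r. \<gamma> r ^ e) * Ti)"
    hence ab: "a < J" "b < J" using T inv(3) by auto
    have "(U * mat_diag L (\<lambda>j. of_nat L * \<beta> ^ (e * j)) * transpose_mat U') $$ (a, b) =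
      (\<Sum>j<L. U $$ (a, j) * (of_nat L * \<beta> ^ (e * j)) * U' $$ (b, j))"
      using ab assms(10,11) by (subst index_mult_mat_eq_sum[of _ J L _ J])
        (auto simp: mat_diag_mult_right[OF assms(10)])
    also have "\<dots> = (\<Sum>j\<in>?S. U $$ (a, j) * (of_nat L * \<beta> ^ (e * j)) * U' $$ (b, j))"
      using zero[OF ab] S by (intro sum.mono_neutral_right) auto
    also have "\<dots> = (\<Sum>r<J. U $$ (a, pick ?S r) * (of_nat L * \<beta> ^ (e * pick ?S r)) * U' $$ (b, pick ?S r))"
      by (rule sum.reindex_bij_betw[OF pick, symmetric])
    also have "\<dots> = (\<Sum>r<J. T $$ (a, r) * \<gamma> r ^ e * Ti $$ (r, b))"
    proof (intro sum.cong refl)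
      fix r assume "r \<in> {..<J}"
      hence r: "r < J" by simp
      have "T $$ (a, r) = U $$ (a, pick ?S r)"
        using index_select_cols[OF assms(10) S ab(1), of r] r assms(5) by (simp add: T_def)
      moreover have "\<gamma> r ^ e = \<beta> ^ (e * pick ?S r)"
        unfolding \<gamma>_def power_mult[symmetric] by (simp only: mult.commute)
      ultimately show "U $$ (a, pick ?S r) * (of_nat L * \<beta> ^ (e * pick ?S r)) * U' $$ (b, pick ?S r) =
        T $$ (a, r) * \<gamma> r ^ e * Ti $$ (r, b)"
        using U'_entry[OF r ab(2)] L0 by simp
    qed
    also have "\<dots> = (T * mat_diag J (\<lambda>r. \<gamma> r ^ e) * Ti) $$ (a, b)"
      using ab T inv(3) by (subst index_mult_mat_eq_sum[of _ J J _ J])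
        (auto simp: mat_diag_mult_right[OF T])
    finally show "(U * mat_diag L (\<lambda>j. of_nat L * \<beta> ^ (e * j)) * transpose_mat U') $$ (a, b) =
      (T * mat_diag J (\<lambda>r. \<gamma> r ^ e) * Ti) $$ (a, b)" .
  qed (use T inv(3) assms(10,11) in auto)
  interpret shift_diagonalized \<phi> L J P Q T Ti \<gamma>
    using assms(1,2,6) carrier T inv diag by unfold_locales auto
  have "primitive_root_of_unity L (\<gamma> r)" if "r < J" for r
  proof -
    have "pick ?S r \<in> ?S" using pick that by (auto simp: bij_betw_def)
    thus ?thesis
      unfolding \<gamma>_def by (intro primitive_root_power[OF assms(9)]) (simp add: coprime_indices_def)
  qed
  hence "full_rank_combinations L J n P Q (\<lambda>j. (j + c) mod L)" for c
    using full_rank_combinations_consecutive[of n c] assms(3,4,6,19) by simp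
  \<comment> \<open>Positivity of \<open>J\<close> comes from the chain \<open>1 \<le> k\<close>,
    \<open>k \<le> n\<close>, \<open>n \<le> m\<close>, \<open>m \<le> J\<close>.\<close>
  moreover have "is_MRD_code J n (q ^ (J * k)) (n - k + 1) (circ_shift_code L J n k P Q l)"
    if "full_rank_combinations L J n P Q l" for l
    using is_MRD_circ_shift_code[OF that, of k] assms(6,17-20) by simp
  ultimately show ?thesis by blast
qed

end
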